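(* Let $1\le p<\infty$ and $\alpha,\beta>-1$. Let $\Phi\in\mathscr{L}\cup\mathscr{U}$, let $\vec{\varepsilon}\in\{0,1\}^2$, put $\omega=\mathcal{T}_\Phi^{\vec{\varepsilon}}$, and let $k\in\mathbb{R}$. Then the following assertions are equivalent. (a) The operator $H_\beta$ is bounded on $L^p((0,\infty),\omega^k(y)y^\alpha\,dy)$. (b) The parameters satisfy $\alpha+1<p(\beta+1)$.
   Context: The Hilbert-type operator $H_\beta$ is defined by $H_\beta f(x)=\int_0^\infty\frac{f(y)y^\beta\,dy}{(x+y)^{1+\beta}}$, $x>0$. $L^p((0,\infty),\omega^k(y)y^\alpha dy)$ is the usual $L^p$ space on $(0,\infty)$ with respect to the measure $\omega^k(y)y^\alpha dy$. Growth functions and weights: a growth function is a continuous, nondecreasing, onto function $\Phi:[0,\infty)\to[0,\infty)$, not identically null. For $r>0$, $\Phi$ is of upper-type $r$ (resp. lower-type $r$) if there is $C_r>0$ such that for all $t\ge 1$ (resp. all $0<t\le 1$) and all $s>0$, $\Phi(st)\le C_r t^r\Phi(s)$. $\mathscr{U}^r$ ($r\ge1$) is the set of growth functions of upper-type $r$ such that $t\mapsto\Phi(t)/t$ is nondecreasing on $(0,\infty)$; $\mathscr{L}_r$ ($0<r\le1$) is the set of growth functions of lower-type $r$ such that $t\mapsto\Phi(t)/t$ is nonincreasing on $(0,\infty)$. $\mathscr{U}=\bigcup_{r\ge1}\mathscr{U}^r$, $\mathscr{L}=\bigcup_{0<r\le1}\mathscr{L}_r$. For $\vec{\varepsilon}=(\varepsilon_1,\varepsilon_2)\in\{0,1\}^2$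 and $t>0$, $\mathcal{T}_\Phi^{\vec{\varepsilon}}(t)=1+\varepsilon_1\ln_+(\Phi(1/t))+\varepsilon_2\ln_+(\Phi(t))$, where $\ln_+=\max(\ln,0)$. *)

theory Defs
  imports "HOL-Analysis.Analysis"
begin

text \<open>
  Growth functions are functions on \<open>[0,\<infinity>)\<close>; they are represented by total functions on the
  reals whose values at negative arguments are irrelevant.
\<close>

definition growth_function :: "(real \<Rightarrow> real) \<Rightarrow> bool" where
  "growth_function \<Phi> \<longleftrightarrow>
     continuous_on {0..} \<Phi> \<and> mono_on {0..} \<Phi> \<and> \<Phi> ` {0..} = {0..} \<and> (\<exists>t\<ge>0. \<Phi> t \<noteq> 0)"

definition upper_type :: "real \<Rightarrow> (real \<Rightarrow> real) \<Rightarrow> bool" where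
  "upper_type r \<Phi> \<longleftrightarrow> (\<exists>C>0. \<forall>t\<ge>1. \<forall>s>0. \<Phi> (s * t) \<le> C * t powr r * \<Phi> s)"

definition lower_type :: "real \<Rightarrow> (real \<Rightarrow> real) \<Rightarrow> bool" where
  "lower_type r \<Phi> \<longleftrightarrow> (\<exists>C>0. \<forall>t\<in>{0<..1}. \<forall>s>0. \<Phi> (s * t) \<le> C * t powr r * \<Phi> s)"

definition growth_upper_of :: "real \<Rightarrow> (real \<Rightarrow> real) set" where
  "growth_upper_of r =
     {\<Phi>. growth_function \<Phi> \<and> upper_type r \<Phi> \<and> mono_on {0<..} (\<lambda>t. \<Phi> t / t)}"

definition growth_lower_of :: "real \<Rightarrow> (real \<Rightarrow> real) set" where
  "growth_lower_of r =
     {\<Phi>. growth_function \<Phi> \<and> lower_type r \<Phi> \<and> antimono_on {0<..} (\<lambda>t. \<Phi> t / t)}"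

definition growth_upper :: "(real \<Rightarrow> real) set" where
  "growth_upper = (\<Union>r\<in>{1..}. growth_upper_of r)"

definition growth_lower :: "(real \<Rightarrow> real) set" where
  "growth_lower = (\<Union>r\<in>{0<..1}. growth_lower_of r)"

text \<open>
  Only used for \<open>x > 0\<close>: the functions in \<open>growth_lower \<union> growth_upper\<close> are positive on \<open>(0,\<infinity>)\<close>,
  so the library's convention for the logarithm of nonpositive numbers plays no role.
\<close>

definition ln_plus :: "real \<Rightarrow> real" where
  "ln_plus x = max (ln x) 0"

definition log_weight :: "(real \<Rightarrow> real) \<Rightarrow> real \<times> real \<Rightarrow> real \<Rightarrow> real" where
  "log_weight \<Phi> \<epsilon> t = 1 + fst \<epsilon> * ln_plus (\<Phi> (1 / t)) + snd \<epsilon> * ln_plus (\<Phi> t)"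

text \<open>
  The measure \<open>\<omega>\<^sup>k(y) y\<^sup>\<alpha> dy\<close> on \<open>(0,\<infinity>)\<close>.  Borel instead of Lebesgue measurability makes no
  difference to \<open>L\<^sup>p\<close>, since every Lebesgue measurable function agrees almost everywhere with
  a Borel measurable one.
\<close>

definition weighted_measure :: "(real \<Rightarrow> real) \<Rightarrow> real \<Rightarrow> real \<Rightarrow> real measure" where
  "weighted_measure \<omega> k \<alpha> =
     density (restrict_space lborel {0<..}) (\<lambda>y. ennreal (\<omega> y powr k * y powr \<alpha>))"

text \<open>Functions rather than classes modulo almost everywhere equality.\<close>

definition Lp :: "real \<Rightarrow> 'a measure \<Rightarrow> ('a \<Rightarrow> complex) set" where
  "Lp p M = {f \<in> borel_measurable M. integrable M (\<lambda>x. norm (f x) powr p)}"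

definition Lp_norm :: "real \<Rightarrow> 'a measure \<Rightarrow> ('a \<Rightarrow> complex) \<Rightarrow> real" where
  "Lp_norm p M f = (LINT x|M. norm (f x) powr p) powr (1 / p)"

definition Hilbert_integrand :: "real \<Rightarrow> (real \<Rightarrow> complex) \<Rightarrow> real \<Rightarrow> real \<Rightarrow> complex" where
  "Hilbert_integrand \<beta> f x y =
     f y * complex_of_real (y powr \<beta>) / complex_of_real ((x + y) powr (1 + \<beta>))"

definition Hilbert_operator :: "real \<Rightarrow> (real \<Rightarrow> complex) \<Rightarrow> real \<Rightarrow> complex" where
  "Hilbert_operator \<beta> f x = (LINT y:{0<..}|lborel. Hilbert_integrand \<beta> f x y)"

text \<open>
  Since the library integral of a non-integrable function is \<open>0\<close>, well-definedness of the
  operator on \<open>L\<^sup>p\<close>, i.e. absolute convergence of the defining integral at almost every \<open>x\<close>,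
  has to be required explicitly.
\<close>

definition Hilbert_operator_bounded_on :: "real \<Rightarrow> real \<Rightarrow> real measure \<Rightarrow> bool" where
  "Hilbert_operator_bounded_on \<beta> p M \<longleftrightarrow>
     (\<exists>C\<ge>0. \<forall>f\<in>Lp p M.
        (AE x in M. set_integrable lborel {0<..} (Hilbert_integrand \<beta> f x)) \<and>
        Hilbert_operator \<beta> f \<in> Lp p M \<and>
        Lp_norm p M (Hilbert_operator \<beta> f) \<le> C * Lp_norm p M f)"

end

(*
  Sufficiency: the weight is slowly varying, i.e. omega(x)^k / omega(y)^k is dominated by any
  positive power of max(x/y, y/x), so the Schur test applies with the test function
  y^(-(alpha+1)/p), just as for the unweighted measure y^alpha dy.

  Necessity: if g = alpha - p (beta + 1) >= -1, test on f(y) = y^(-beta-1) on [A, A R^2].  The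
  operator gains a factor ln R on the upper half [A R, A R^2].  Choosing A so large that omega is
  essentially constant on the interval, the upper half carries a fixed proportion of the norm of f,
  and R -> infinity contradicts boundedness.  The position of the interval takes care of the critical
  case g = -1 for all signs of k at once.
*)

theory Submission
  imports Defs
begin

text \<open>Put a = (\<alpha>+1)/p. For the measure y^\<alpha> dy both integrals of the Schur test
  converge when 0 < a < \<beta>+1; the left inequality is \<alpha> > -1 and the right one is (b).
  Since this window is open, the exponents a + \<delta> and a - \<delta> with small \<delta> > 0
  behave in the same way, and this room pays for the weight.

  In the critical case no single test function is good for every k. For \<Phi>(t) = t, \<epsilon> =
  (0,1) and k < -p-1, both y^(-\<beta>-1) on [1,\<infinity>) and its image, of order x^(-\<beta>-1)
  ln x at infinity, lie in L^p. Hence the contradiction comes from norms on finite intervals, and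
  there the order of the choices matters: the comparison constant of the weight must be fixed before
  R, whereas slow variation alone gives a ratio that may grow with R. Placing the interval after R
  is chosen removes this growth: either \<omega> is bounded on [1,\<infinity>), or it tends to
  infinity and its oscillation, of order 1 + ln R, is absorbed by its size.\<close>

section \<open>Convexity, Hoelder's inequality and the Schur test\<close>

lemma powr_ge_tangent:
  fixes x c p :: real
  assumes "1 \<le> p" "0 \<le> x" "0 < c"
  shows "c powr p + p * c powr (p - 1) * (x - c) \<le> x powr p"
proof (cases "x = 0")
  case True
  have "1 * c powr p \<le> p * c powr p"
    using assms by (intro mult_right_mono) auto
  moreover have "c powr (p - 1) * c = c powr p"
    using assms by (simp add: powr_diff)
  ultimately show ?thesis
    using True assms by (simp add: algebra_simps)
next
  case False
  then have "x / c > 0" using assms by simp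
  \<comment> \<open>Weighted AM-GM for (x/c)^p and 1, which amounts to Bernoulli's inequality. The
    weight 1 - 1/p may be 0, so p = 1 is included; positivity of the arguments is why x = 0 was
    split off.\<close>
  have "((x / c) powr p) powr (1 / p) * 1 powr (1 - 1 / p) \<le> 1 / p * (x / c) powr p + (1 - 1 / p) * 1"
    using assms \<open>x / c > 0\<close> by (intro Youngs_inequality_0) auto
  then have "x / c \<le> 1 / p * (x / c) powr p + (1 - 1 / p)"
    using assms \<open>x / c > 0\<close> by (simp add: powr_powr)
  then have "p * (x / c) \<le> p * (1 / p * (x / c) powr p + (1 - 1 / p))"
    using assms by (intro mult_left_mono) auto
  also have "p * (1 / p * (x / c) powr p + (1 - 1 / p)) = (x / c) powr p + p - 1"
    using assms by (simp add: distrib_left right_diff_distrib)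
  finally have "1 + p * (x / c - 1) \<le> (x / c) powr p"
    by (simp add: right_diff_distrib)
  then have "c powr p * (1 + p * (x / c - 1)) \<le> c powr p * (x / c) powr p"
    by (intro mult_left_mono) auto
  also have "c powr p * (x / c) powr p = x powr p"
    using assms by (simp add: powr_divide)
  also have "c powr p * (1 + p * (x / c - 1)) = c powr p + p * c powr (p - 1) * (x - c)"
    using assms by (simp add: powr_diff field_simps)
  finally show ?thesis .
qed

text \<open>Jensen's inequality for t^p, obtained by integrating a tangent line. No conjugate
  exponent occurs, so p = 1 needs no separate treatment. An upper bound V for the total mass is
  enough, because in the integrated tangent the mass has the coefficient (1 - p) c^p \<le>
  0.\<close>

lemma Holder_weighted:
  fixes F v :: "'a \<Rightarrow> real"
  assumes p: "1 \<le> p"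
    and [measurable]: "F \<in> borel_measurable M"
    and v: "integrable M v" "\<And>x. x \<in> space M \<Longrightarrow> 0 \<le> v x"
    and V: "(LINT x|M. v x) \<le> V" "0 < V"
    and F: "\<And>x. x \<in> space M \<Longrightarrow> 0 \<le> F x" "integrable M (\<lambda>x. F x powr p * v x)"
  shows "integrable M (\<lambda>x. F x * v x)"
    and "(LINT x|M. F x * v x) powr p \<le> V powr (p - 1) * (LINT x|M. F x powr p * v x)"
proof -
  have [measurable]: "v \<in> borel_measurable M" using v by auto
  have le: "F x * v x \<le> F x powr p * v x + v x" if x: "x \<in> space M" for x
  proof -
    have "F x \<le> F x powr p + 1"
    proof (cases "F x \<le> 1")
      case False
      then have "F x powr 1 \<le> F x powr p" using p by (intro powr_mono) auto
      then show ?thesis using False by simp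
    qed (simp add: add_increasing)
    then have "F x * v x \<le> (F x powr p + 1) * v x" using v(2)[OF x] by (intro mult_right_mono)
    then show ?thesis by (simp add: algebra_simps)
  qed
  have int: "integrable M (\<lambda>x. F x powr p * v x + v x)"
    using F(2) v(1) by auto
  show int1: "integrable M (\<lambda>x. F x * v x)"
    by (rule Bochner_Integration.integrable_bound[OF int])
       (auto intro!: AE_I2 intro: order.trans[OF le] simp: F v)
  let ?m = "LINT x|M. F x * v x" and ?J = "LINT x|M. F x powr p * v x"
  have m0: "0 \<le> ?m" and J0: "0 \<le> ?J" by (auto intro!: integral_nonneg_AE AE_I2 simp: F v)
  show "?m powr p \<le> V powr (p - 1) * ?J"
  proof (cases "?m = 0")
    case True
    then show ?thesis using J0 p by simp
  next
    case False
    \<comment> \<open>The point of tangency is the mean of \<open>F\<close>, with V in place of the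
      exact mass; there the tangent bound collapses to c^p V.\<close>
    define c where "c = ?m / V"
    have c: "c > 0" using False m0 V by (simp add: c_def)
    have "(LINT x|M. (1 - p) * c powr p * v x + p * c powr (p - 1) * (F x * v x)) \<le> ?J"
    proof (rule integral_mono)
      fix x assume x: "x \<in> space M"
      have "p * (c powr (p - 1) * c) = p * c powr p" using c by (simp add: powr_diff)
      then have "(1 - p) * c powr p + p * c powr (p - 1) * F x
          = c powr p + p * c powr (p - 1) * (F x - c)"
        by (simp add: algebra_simps)
      also have "\<dots> \<le> F x powr p"
        by (rule powr_ge_tangent[OF p F(1)[OF x] c])
      finally have "((1 - p) * c powr p + p * c powr (p - 1) * F x) * v x \<le> F x powr p * v x"
        using v(2)[OF x] by (rule mult_right_mono)
      then show "(1 - p) * c powr p * v x + p * c powr (p - 1) * (F x * v x) \<le> F x powr p * v x"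
        by (simp add: distrib_right mult.assoc)
    qed (use v(1) int1 F(2) in auto)
    then have "(1 - p) * c powr p * (LINT x|M. v x) + p * c powr (p - 1) * ?m \<le> ?J"
      using v(1) int1 by simp
    moreover have "(1 - p) * c powr p * V \<le> (1 - p) * c powr p * (LINT x|M. v x)"
      using V p by (intro mult_left_mono_neg) (auto simp: mult_nonpos_nonneg)
    moreover have "p * (c powr (p - 1) * c) * V = p * c powr p * V"
      using c by (simp add: powr_diff)
    then have "p * c powr (p - 1) * ?m = p * c powr p * V"
      using V by (simp add: c_def)
    moreover have "(1 - p) * c powr p * V + p * c powr p * V = c powr p * V"
      by (simp add: algebra_simps)
    ultimately have "c powr p * V \<le> ?J" by linarith
    then have "V powr (p - 1) * (c powr p * V) \<le> V powr (p - 1) * ?J"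
      by (intro mult_left_mono) auto
    also have "V powr (p - 1) * (c powr p * V) = ?m powr p"
      using V m0 by (simp add: c_def powr_divide powr_diff)
    finally show ?thesis .
  qed
qed

text \<open>Cut at y = x and bound x + y below by the larger of the two variables. The lower bound
  on \<open>b\<close> gives convergence at 0, the upper bound convergence at infinity, and each
  piece contributes one summand of \<open>B\<close>. The exact constant would be a Beta value; only
  its finiteness matters here.\<close>

lemma nn_integral_powr_kernel_le:
  fixes b \<beta> :: real
  assumes b: "-1 < b" "b < \<beta>"
  obtains B where "0 < B"
    "\<And>x. 0 < x \<Longrightarrow> (\<integral>\<^sup>+y. ennreal (y powr b / (x + y) powr (1 + \<beta>)) \<partial>restrict_space lborel {0<..})
       \<le> ennreal (B * x powr (b - \<beta>))"
proof -
  define B where "B = 1 / (b + 1) + 1 / (\<beta> - b)"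
  have "B > 0" using b by (auto simp: B_def intro!: add_pos_pos)
  moreover have "(\<integral>\<^sup>+y. ennreal (y powr b / (x + y) powr (1 + \<beta>)) \<partial>restrict_space lborel {0<..})
       \<le> ennreal (B * x powr (b - \<beta>))" if x: "0 < x" for x
  proof -
    define g1 where "g1 y = (if y \<in> {0..x} then y powr b else 0)" for y
    define g2 where "g2 y = (if y \<in> {x..} then y powr (b - 1 - \<beta>) else 0)" for y
    have [measurable]: "g1 \<in> borel_measurable borel" "g2 \<in> borel_measurable borel"
      unfolding g1_def g2_def by measurable
    have "(g1 has_integral x powr (b + 1) / (b + 1)) UNIV"
      using has_integral_powr_from_0[of b x] b x
      unfolding g1_def has_integral_restrict_UNIV by simp
    then have g1: "(\<integral>\<^sup>+y. g1 y \<partial>lborel) = ennreal (x powr (b + 1) / (b + 1))"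
      by (rule nn_integral_has_integral_lborel[rotated 2]) (measurable, simp add: g1_def)
    have "(g2 has_integral x powr (b - \<beta>) / (\<beta> - b)) UNIV"
      using has_integral_powr_to_inf[of "b - 1 - \<beta>" x] b x
      unfolding g2_def has_integral_restrict_UNIV by (simp add: minus_divide_right)
    then have g2: "(\<integral>\<^sup>+y. g2 y \<partial>lborel) = ennreal (x powr (b - \<beta>) / (\<beta> - b))"
      by (rule nn_integral_has_integral_lborel[rotated 2]) (measurable, simp add: g2_def)
    have pw: "y powr b / (x + y) powr (1 + \<beta>) \<le> x powr (- 1 - \<beta>) * g1 y + g2 y" if y: "0 < y" for y
    proof (cases "y \<le> x")
      case True
      have "y powr b / (x + y) powr (1 + \<beta>) \<le> y powr b / x powr (1 + \<beta>)"
        using x y b by (intro divide_left_mono powr_mono2) auto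
      also have "\<dots> = x powr (- (1 + \<beta>)) * g1 y"
        unfolding powr_minus using True y by (simp add: g1_def field_simps)
      finally show ?thesis by (simp add: g2_def add_increasing2)
    next
      case False
      have "y powr b / (x + y) powr (1 + \<beta>) \<le> y powr b / y powr (1 + \<beta>)"
        using x y b by (intro divide_left_mono powr_mono2) auto
      also have "\<dots> = g2 y"
        using False y by (simp add: g2_def diff_diff_add flip: powr_diff)
      finally show ?thesis using False by (simp add: g1_def)
    qed
    have "(\<integral>\<^sup>+y. ennreal (y powr b / (x + y) powr (1 + \<beta>)) \<partial>restrict_space lborel {0<..})
      \<le> (\<integral>\<^sup>+y. ennreal (x powr (- 1 - \<beta>)) * ennreal (g1 y) + ennreal (g2 y) \<partial>lborel)"
    proof (subst nn_integral_restrict_space, simp, rule nn_integral_mono)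
      fix y :: real
      have "ennreal (y powr b / (x + y) powr (1 + \<beta>)) \<le> ennreal (x powr (- 1 - \<beta>) * g1 y + g2 y)"
        if "0 < y" by (intro ennreal_leI pw that)
      also have "ennreal (x powr (- 1 - \<beta>) * g1 y + g2 y)
          = ennreal (x powr (- 1 - \<beta>)) * ennreal (g1 y) + ennreal (g2 y)"
        by (simp add: g1_def g2_def ennreal_mult')
      finally show "ennreal (y powr b / (x + y) powr (1 + \<beta>)) * indicator {0<..} y
          \<le> ennreal (x powr (- 1 - \<beta>)) * ennreal (g1 y) + ennreal (g2 y)"
        by (simp add: indicator_def)
    qed
    also have "\<dots> = ennreal (x powr (- 1 - \<beta>)) * ennreal (x powr (b + 1) / (b + 1)) + ennreal (x powr (b - \<beta>) / (\<beta> - b))"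
      by (simp add: nn_integral_add nn_integral_cmult g1 g2)
    also have "\<dots> = ennreal (x powr (- 1 - \<beta>) * (x powr (b + 1) / (b + 1)) + x powr (b - \<beta>) / (\<beta> - b))"
      using b by (simp flip: ennreal_mult')
    also have "x powr (- 1 - \<beta>) * (x powr (b + 1) / (b + 1)) + x powr (b - \<beta>) / (\<beta> - b) = B * x powr (b - \<beta>)"
      using x by (simp add: B_def algebra_simps flip: powr_add)
    finally show ?thesis .
  qed
  ultimately show ?thesis by (rule that)
qed

text \<open>Hoelder's inequality for |f|/s and the measure K(x,y) s(y) dN(y) bounds |T x|^p by (B1
  s(x))^(p-1) times an integral of |f|^p; Tonelli and the column condition finish. The column
  condition carries s^(p-1) instead of a conjugate exponent, which keeps p = 1. The weight
  \<open>W\<close> is separated from \<open>N\<close> because the operator integrates against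
  \<open>N\<close>, while the norms use the density \<open>W\<close>.\<close>

proposition Schur_test:
  fixes N :: "'a measure" and K :: "'a \<Rightarrow> 'a \<Rightarrow> real" and s W :: "'a \<Rightarrow> real" and f :: "'a \<Rightarrow> complex"
  assumes "sigma_finite_measure N" and p: "1 \<le> p"
    and K[measurable]: "case_prod K \<in> borel_measurable (N \<Otimes>\<^sub>M N)"
    and [measurable]: "s \<in> borel_measurable N" "W \<in> borel_measurable N"
    and K0: "\<And>x y. x \<in> space N \<Longrightarrow> y \<in> space N \<Longrightarrow> 0 \<le> K x y"
    and s0: "\<And>x. x \<in> space N \<Longrightarrow> 0 < s x"
    and W0: "\<And>x. x \<in> space N \<Longrightarrow> 0 < W x"
    and B: "0 < B1" "0 < B2"
    and row: "\<And>x. x \<in> space N \<Longrightarrow> (\<integral>\<^sup>+y. ennreal (K x y * s y) \<partial>N) \<le> ennreal (B1 * s x)"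
    and col: "\<And>y. y \<in> space N \<Longrightarrow>
      (\<integral>\<^sup>+x. ennreal (K x y * s x powr (p - 1) * W x) \<partial>N) \<le> ennreal (B2 * s y powr (p - 1) * W y)"
    and f: "f \<in> Lp p (density N (\<lambda>x. ennreal (W x)))"
  defines "T \<equiv> \<lambda>x. LINT y|N. f y * complex_of_real (K x y)"
  shows "AE x in density N (\<lambda>x. ennreal (W x)). integrable N (\<lambda>y. f y * complex_of_real (K x y))"
    and "T \<in> Lp p (density N (\<lambda>x. ennreal (W x)))"
    and "(LINT x|density N (\<lambda>x. ennreal (W x)). norm (T x) powr p)
      \<le> B1 powr (p - 1) * B2 * (LINT x|density N (\<lambda>x. ennreal (W x)). norm (f x) powr p)"
proof -
  interpret N: sigma_finite_measure N by fact
  interpret NN: pair_sigma_finite N N ..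
  let ?M = "density N (\<lambda>x. ennreal (W x))"
  have [measurable]: "f \<in> borel_measurable N" using f by (simp add: Lp_def)
  have [measurable]: "T \<in> borel_measurable N" unfolding T_def by measurable
  define I where "I = (LINT x|?M. norm (f x) powr p)"
  have I0: "0 \<le> I" unfolding I_def by simp
  have "(\<integral>\<^sup>+x. ennreal (norm (f x) powr p) \<partial>?M) = ennreal I"
    using f unfolding I_def by (intro nn_integral_eq_integral) (auto simp: Lp_def)
  then have I: "(\<integral>\<^sup>+x. ennreal (W x) * ennreal (norm (f x) powr p) \<partial>N) = ennreal I"
    by (simp add: nn_integral_density)

  \<comment> \<open>The right-hand integral of Hoelder's inequality: (|f|/s)^p s = |f|^p s^(1-p). It
    is taken in the extended reals so that Tonelli applies before finiteness is known.\<close>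
  define u where "u x = (\<integral>\<^sup>+y. ennreal (norm (f y) powr p * s y powr (1 - p) * K x y) \<partial>N)" for x
  have u_meas[measurable]: "u \<in> borel_measurable N" unfolding u_def by measurable

  define c where "c x = (B1 * s x) powr (p - 1)" for x
  have [measurable]: "c \<in> borel_measurable N" unfolding c_def by measurable
  have c_pos: "c x > 0" if "x \<in> space N" for x using s0[OF that] B by (simp add: c_def)

  have "(\<integral>\<^sup>+x. ennreal (c x * W x) * u x \<partial>N)
      = (\<integral>\<^sup>+x. \<integral>\<^sup>+y. ennreal (c x * W x) * ennreal (norm (f y) powr p * s y powr (1 - p) * K x y) \<partial>N \<partial>N)"
    unfolding u_def by (intro nn_integral_cong nn_integral_cmult[symmetric]) measurable
  also have "\<dots> = (\<integral>\<^sup>+y. \<integral>\<^sup>+x. ennreal (c x * W x) * ennreal (norm (f y) powr p * s y powr (1 - p) * K x y) \<partial>N \<partial>N)"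
    by (intro NN.Fubini'[symmetric]) measurable
  also have "\<dots> \<le> (\<integral>\<^sup>+y. ennreal (B1 powr (p - 1) * B2) * (ennreal (W y) * ennreal (norm (f y) powr p)) \<partial>N)"
  proof (rule nn_integral_mono)
    fix y assume y: "y \<in> space N"
    define d where "d = B1 powr (p - 1) * norm (f y) powr p * s y powr (1 - p)"
    have d0: "d \<ge> 0" by (simp add: d_def)
    have "(\<integral>\<^sup>+x. ennreal (c x * W x) * ennreal (norm (f y) powr p * s y powr (1 - p) * K x y) \<partial>N)
       = (\<integral>\<^sup>+x. ennreal d * ennreal (K x y * s x powr (p - 1) * W x) \<partial>N)"
    proof (rule nn_integral_cong)
      fix x assume x: "x \<in> space N"
      have "(c x * W x) * (norm (f y) powr p * s y powr (1 - p) * K x y) = d * (K x y * s x powr (p - 1) * W x)"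
        using s0[OF x] B by (simp add: c_def d_def powr_mult)
      moreover have "0 \<le> c x * W x" using c_pos[OF x] W0[OF x] by simp
      ultimately show "ennreal (c x * W x) * ennreal (norm (f y) powr p * s y powr (1 - p) * K x y)
          = ennreal d * ennreal (K x y * s x powr (p - 1) * W x)"
        using d0 by (simp only: flip: ennreal_mult')
    qed
    also have "\<dots> = ennreal d * (\<integral>\<^sup>+x. ennreal (K x y * s x powr (p - 1) * W x) \<partial>N)"
      using y by (intro nn_integral_cmult) measurable
    also have "\<dots> \<le> ennreal d * ennreal (B2 * s y powr (p - 1) * W y)"
      by (intro mult_left_mono col y) simp
    also have "\<dots> = ennreal (d * (B2 * s y powr (p - 1) * W y))"
      using d0 by (rule ennreal_mult'[symmetric])
    also have "s y powr (1 - p) * s y powr (p - 1) = 1"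
      using s0[OF y] by (simp flip: powr_add)
    then have "d * (B2 * s y powr (p - 1) * W y) = B1 powr (p - 1) * B2 * (W y * norm (f y) powr p)"
      by (simp add: d_def algebra_simps)
    finally show "(\<integral>\<^sup>+x. ennreal (c x * W x) * ennreal (norm (f y) powr p * s y powr (1 - p) * K x y) \<partial>N)
        \<le> ennreal (B1 powr (p - 1) * B2) * (ennreal (W y) * ennreal (norm (f y) powr p))"
      using B W0[OF y] by (simp add: ennreal_mult)
  qed
  also have "\<dots> = ennreal (B1 powr (p - 1) * B2) * ennreal I"
    by (subst nn_integral_cmult) (simp_all add: I)
  also have "\<dots> = ennreal (B1 powr (p - 1) * B2 * I)"
    using B by (simp add: ennreal_mult')
  finally have main: "(\<integral>\<^sup>+x. ennreal (c x * W x) * u x \<partial>N) \<le> ennreal (B1 powr (p - 1) * B2 * I)" .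

  \<comment> \<open>The factor c W is strictly positive, so a finite weighted integral forces u <
    \<infinity> almost everywhere. At such points the integral defining \<open>T\<close> converges
    absolutely and Hoelder's inequality is available.\<close>
  have "AE x in N. ennreal (c x * W x) * u x \<noteq> \<infinity>"
    using main by (intro nn_integral_PInf_AE) (auto simp: top_unique)
  then have ufin: "AE x in N. u x < \<infinity>"
  proof (rule AE_mp, intro AE_I2 impI)
    fix x assume x: "x \<in> space N" and "ennreal (c x * W x) * u x \<noteq> \<infinity>"
    moreover have "0 < c x * W x" using c_pos[OF x] W0[OF x] by simp
    ultimately show "u x < \<infinity>"
      by (auto simp: ennreal_mult_eq_top_iff less_top)
  qed

  have key: "integrable N (\<lambda>y. f y * complex_of_real (K x y))" (is ?A)
      "ennreal (norm (T x) powr p) \<le> ennreal (c x) * u x" (is ?B)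
    if x: "x \<in> space N" and ux: "u x < \<infinity>" for x
  proof -
    define F where "F y = norm (f y) / s y" for y
    have Fs: "F y * (K x y * s y) = norm (f y * complex_of_real (K x y))" if "y \<in> space N" for y
      using s0[OF that] K0[OF x that] by (simp add: F_def norm_mult)
    have Fp: "F y powr p * (K x y * s y) = norm (f y) powr p * s y powr (1 - p) * K x y" if "y \<in> space N" for y
      using s0[OF that] by (simp add: F_def powr_divide powr_diff)
    have intK: "integrable N (\<lambda>y. K x y * s y)"
      using row[OF x] x K0 s0 by (intro integrableI_nonneg AE_I2) (auto simp: less_imp_le le_less_trans)
    have rowi: "(LINT y|N. K x y * s y) \<le> B1 * s x"
      using row[OF x] x K0 s0 B by (intro integral_real_bounded) (auto simp: less_imp_le)
    have intF: "integrable N (\<lambda>y. F y powr p * (K x y * s y))"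
    proof -
      have "integrable N (\<lambda>y. norm (f y) powr p * s y powr (1 - p) * K x y)"
        using ux x K0 unfolding u_def by (intro integrableI_nonneg AE_I2) auto
      then show ?thesis
        by (rule Bochner_Integration.integrable_cong[THEN iffD1, rotated 2]) (simp_all add: Fp)
    qed
    have [measurable]: "F \<in> borel_measurable N" unfolding F_def by measurable
    note H = Holder_weighted[OF p \<open>F \<in> borel_measurable N\<close> intK _ rowi _ _ intF]
    have 1: "integrable N (\<lambda>y. F y * (K x y * s y))"
      using x s0 K0 B by (intro H) (auto simp: F_def less_imp_le)
    then have "integrable N (\<lambda>y. norm (f y * complex_of_real (K x y)))"
      by (rule Bochner_Integration.integrable_cong[THEN iffD1, rotated 2]) (simp_all add: Fs)
    then show ?A
      using x by (subst (asm) integrable_norm_iff) measurable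
    have "norm (T x) \<le> (LINT y|N. norm (f y * complex_of_real (K x y)))"
      unfolding T_def by (rule integral_norm_bound)
    also have "\<dots> = (LINT y|N. F y * (K x y * s y))"
      by (intro Bochner_Integration.integral_cong) (simp_all add: Fs)
    finally have "norm (T x) powr p \<le> (LINT y|N. F y * (K x y * s y)) powr p"
      using p by (intro powr_mono2) auto
    also have "\<dots> \<le> c x * (LINT y|N. F y powr p * (K x y * s y))"
      unfolding c_def using x s0 K0 B by (intro H) (auto simp: F_def less_imp_le)
    finally have "ennreal (norm (T x) powr p) \<le> ennreal (c x * (LINT y|N. F y powr p * (K x y * s y)))"
      by (rule ennreal_leI)
    also have "\<dots> = ennreal (c x) * ennreal (LINT y|N. F y powr p * (K x y * s y))"
      using c_pos[OF x] by (intro ennreal_mult') simp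
    also have "ennreal (LINT y|N. F y powr p * (K x y * s y)) = (\<integral>\<^sup>+y. ennreal (F y powr p * (K x y * s y)) \<partial>N)"
      using x K0 s0 by (intro nn_integral_eq_integral[symmetric] intF AE_I2) (auto simp: less_imp_le)
    also have "\<dots> = u x"
      unfolding u_def by (intro nn_integral_cong) (simp add: Fp)
    finally show ?B .
  qed

  have "AE x in N. integrable N (\<lambda>y. f y * complex_of_real (K x y))"
    using ufin by (rule AE_mp) (auto intro!: AE_I2 key)
  then show "AE x in ?M. integrable N (\<lambda>y. f y * complex_of_real (K x y))"
    by (subst AE_density) (auto elim: eventually_mono)

  have "(\<integral>\<^sup>+x. ennreal (norm (T x) powr p) \<partial>?M) = (\<integral>\<^sup>+x. ennreal (W x) * ennreal (norm (T x) powr p) \<partial>N)"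
    by (simp add: nn_integral_density)
  also have "\<dots> \<le> (\<integral>\<^sup>+x. ennreal (c x * W x) * u x \<partial>N)"
  proof (rule nn_integral_mono_AE, use ufin in \<open>rule AE_mp\<close>, intro AE_I2 impI)
    fix x assume x: "x \<in> space N" and "u x < \<infinity>"
    then have "ennreal (W x) * ennreal (norm (T x) powr p) \<le> ennreal (W x) * (ennreal (c x) * u x)"
      by (intro mult_left_mono key) auto
    also have "\<dots> = ennreal (c x * W x) * u x"
      using c_pos[OF x] W0[OF x] by (simp add: ennreal_mult mult_ac less_imp_le)
    finally show "ennreal (W x) * ennreal (norm (T x) powr p) \<le> ennreal (c x * W x) * u x" .
  qed
  also note main
  finally have Tn: "(\<integral>\<^sup>+x. ennreal (norm (T x) powr p) \<partial>?M) \<le> ennreal (B1 powr (p - 1) * B2 * I)" .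
  show "T \<in> Lp p ?M"
    unfolding Lp_def using Tn by (auto intro!: integrableI_nonneg AE_I2 intro: le_less_trans)
  show "(LINT x|?M. norm (T x) powr p) \<le> B1 powr (p - 1) * B2 * (LINT x|?M. norm (f x) powr p)"
    unfolding I_def[symmetric] using Tn B I0 by (intro integral_real_bounded) auto
qed

section \<open>Regularity of growth functions and of the logarithmic weight\<close>

lemma growth_function_doubling:
  assumes "\<Phi> \<in> growth_lower \<union> growth_upper"
  obtains C r where "1 \<le> C" "1 \<le> r" "\<And>s t. 1 \<le> t \<Longrightarrow> 0 < s \<Longrightarrow> \<Phi> (s * t) \<le> C * t powr r * \<Phi> s"
  using assms
proof
  assume "\<Phi> \<in> growth_lower"
  \<comment> \<open>A nonincreasing quotient \<Phi>(t)/t is already a growth bound with exponent 1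
    and constant 1, so both classes fall under one estimate.\<close>
  then have anti: "antimono_on {0<..} (\<lambda>t. \<Phi> t / t)"
    by (auto simp: growth_lower_def growth_lower_of_def)
  have "\<Phi> (s * t) \<le> 1 * t powr 1 * \<Phi> s" if "1 \<le> t" "0 < s" for s t
  proof -
    have "s \<le> s * t" using that by simp
    then have "\<Phi> (s * t) / (s * t) \<le> \<Phi> s / s"
      using that by (intro monotone_onD[OF anti, simplified]) auto
    then show ?thesis using that by (simp add: field_simps)
  qed
  then show ?thesis by (intro that[of 1 1]) auto
next
  assume "\<Phi> \<in> growth_upper"
  then obtain r where r: "1 \<le> r" "growth_function \<Phi>" "upper_type r \<Phi>"
    by (auto simp: growth_upper_def growth_upper_of_def)
  then obtain C where C: "C > 0" "\<And>s t. 1 \<le> t \<Longrightarrow> 0 < s \<Longrightarrow> \<Phi> (s * t) \<le> C * t powr r * \<Phi> s"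
    by (auto simp: upper_type_def)
  have nonneg: "0 \<le> \<Phi> s" if "0 < s" for s
    using r(2) that by (auto simp: growth_function_def)
  \<comment> \<open>Raising the constant to at least 1 makes its logarithm nonnegative, as the
    additive estimate for ln \<Phi> requires.\<close>
  have "\<Phi> (s * t) \<le> max C 1 * t powr r * \<Phi> s" if "1 \<le> t" "0 < s" for s t
    using C(2)[OF that] nonneg[OF that(2)]
    by (elim order.trans) (intro mult_right_mono, auto)
  then show ?thesis using r(1) by (intro that[of "max C 1" r]) auto
qed

text \<open>The first comparison serves k \<ge> 0 and the second k < 0; asking for both makes later
  arguments independent of the sign of k.\<close>

lemma powr_quotient_bound:
  assumes "1 \<le> L" and le: "a \<le> L * b" "b \<le> L * a" and "0 < a" "0 < (b::real)"
  shows "a powr k \<le> L powr \<bar>k\<bar> * b powr k"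
proof (cases "0 \<le> k")
  case True
  then show ?thesis using assms powr_mono2[of k a "L * b"] by (simp add: powr_mult)
next
  case False
  have "a powr k \<le> (b / L) powr k"
    using assms False by (intro powr_mono2') (auto simp: field_simps)
  then show ?thesis using assms False by (simp add: powr_divide powr_minus_divide)
qed

locale log_weight_setup =
  fixes \<Phi> :: "real \<Rightarrow> real" and \<epsilon> :: "real \<times> real"
  assumes \<Phi>: "\<Phi> \<in> growth_lower \<union> growth_upper"
    and \<epsilon>: "\<epsilon> \<in> {0, 1} \<times> {0, 1}"
begin

abbreviation "\<omega> \<equiv> log_weight \<Phi> \<epsilon>"

lemma growth: "growth_function \<Phi>"
  using \<Phi> by (auto simp: growth_lower_def growth_lower_of_def growth_upper_def growth_upper_of_def)

lemma mono: "0 \<le> s \<Longrightarrow> s \<le> t \<Longrightarrow> \<Phi> s \<le> \<Phi> t"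
  using growth by (auto simp: growth_function_def intro!: mono_onD[of "{0..}" \<Phi>])

text \<open>A zero at t > 0 would spread to the left by monotonicity and to the right by the growth
  bound, making \<Phi> vanish identically.\<close>

lemma pos:
  assumes t: "0 < t"
  shows "0 < \<Phi> t"
proof (rule ccontr)
  assume "\<not> 0 < \<Phi> t"
  moreover have nonneg: "0 \<le> \<Phi> s" if "0 \<le> s" for s
    using growth that by (auto simp: growth_function_def)
  ultimately have 0: "\<Phi> t = 0" using t by (simp add: antisym)
  obtain C r where C: "\<And>s t. 1 \<le> t \<Longrightarrow> 0 < s \<Longrightarrow> \<Phi> (s * t) \<le> C * t powr r * \<Phi> s"
    using growth_function_doubling[OF \<Phi>] by metis
  have "\<Phi> s = 0" if s: "s \<ge> 0" for s
  proof (cases "s \<le> t")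
    case True
    then show ?thesis using mono[OF s True] nonneg[OF s] 0 by simp
  next
    case False
    then show ?thesis using C[of "s / t" t] t nonneg[OF s] 0 by simp
  qed
  then show False using growth by (auto simp: growth_function_def)
qed

lemma ge_1: "1 \<le> \<omega> t"
  using \<epsilon> by (auto simp: log_weight_def ln_plus_def)

text \<open>Scaling the argument changes \<Phi> by at most a power of the scale, hence ln \<Phi> by
  at most a linear function of its logarithm. The additive form is worth keeping: where \<omega> is
  large it says more than a bound on the ratio by a function of x/y.\<close>

lemma slowly_varying:
  obtains D where "0 < D" "\<And>x y. 0 < x \<Longrightarrow> 0 < y \<Longrightarrow> \<omega> x \<le> \<omega> y + D * (1 + \<bar>ln (x / y)\<bar>)"
proof -
  obtain C r where C: "1 \<le> C" "1 \<le> r" "\<And>s t. 1 \<le> t \<Longrightarrow> 0 < s \<Longrightarrow> \<Phi> (s * t) \<le> C * t powr r * \<Phi> s"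
    using growth_function_doubling[OF \<Phi>] by metis
  define D where "D = ln C + r"
  have lnC: "0 \<le> ln C" using C by simp
  have lp: "ln_plus (\<Phi> x) \<le> ln_plus (\<Phi> y) + D * (1 + \<bar>ln (x / y)\<bar>)" if xy: "0 < x" "0 < y" for x y
  proof -
    have D: "ln C + r * l \<le> D * (1 + l)" if "0 \<le> l" for l
      using lnC C that by (simp add: D_def algebra_simps)
    have "ln (\<Phi> x) \<le> ln (\<Phi> y) + D * (1 + \<bar>ln (x / y)\<bar>)"
    proof (cases "x \<le> y")
      case True
      then have "ln (\<Phi> x) \<le> ln (\<Phi> y)"
        using mono[of x y] pos[of x] xy by simp
      moreover have "0 \<le> D * (1 + \<bar>ln (x / y)\<bar>)"
        using lnC C by (simp add: D_def)
      ultimately show ?thesis by simp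
    next
      case False
      then have "\<Phi> x \<le> C * (x / y) powr r * \<Phi> y"
        using C(3)[of "x / y" y] xy by simp
      then have "ln (\<Phi> x) \<le> ln (C * (x / y) powr r * \<Phi> y)"
        using pos[of x] xy by (intro ln_mono) auto
      also have "\<dots> = ln C + r * ln (x / y) + ln (\<Phi> y)"
        using C pos[OF xy(2)] xy by (simp add: ln_mult ln_powr)
      finally show ?thesis
        using False xy D[of "ln (x / y)"] by (simp add: abs_of_nonneg)
    qed
    moreover have "0 \<le> D * (1 + \<bar>ln (x / y)\<bar>)"
      using lnC C by (simp add: D_def)
    ultimately show ?thesis by (auto simp: ln_plus_def max_def)
  qed
  \<comment> \<open>One D for each logarithmic term. Passing to reciprocals preserves |ln (x/y)|, so
    the term with \<Phi>(1/t) obeys the same bound.\<close>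
  have "\<omega> x \<le> \<omega> y + 2 * D * (1 + \<bar>ln (x / y)\<bar>)" if xy: "0 < x" "0 < y" for x y
  proof -
    define E where "E = D * (1 + \<bar>ln (x / y)\<bar>)"
    have E0: "0 \<le> E" using lnC C by (simp add: E_def D_def)
    have "\<bar>ln ((1 / x) / (1 / y))\<bar> = \<bar>ln (x / y)\<bar>"
      using xy by (simp add: ln_div abs_minus_commute)
    then have "ln_plus (\<Phi> (1 / x)) \<le> ln_plus (\<Phi> (1 / y)) + E"
      using lp[of "1 / x" "1 / y"] xy by (simp add: E_def)
    then have "fst \<epsilon> * ln_plus (\<Phi> (1 / x)) \<le> fst \<epsilon> * ln_plus (\<Phi> (1 / y)) + E"
      using \<epsilon> E0 by auto
    moreover have "snd \<epsilon> * ln_plus (\<Phi> x) \<le> snd \<epsilon> * ln_plus (\<Phi> y) + E"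
      using \<epsilon> E0 lp[OF xy] by (auto simp: E_def)
    ultimately show ?thesis by (simp add: log_weight_def E_def)
  qed
  moreover have "0 < 2 * D" using add_nonneg_pos[of "ln C" r] lnC C(2) by (simp add: D_def)
  ultimately show ?thesis using that by blast
qed

text \<open>Since \<omega> \<ge> 1, the additive bound gives a ratio at most linear in l = |ln
  (x/y)|. Its power is beaten by exp (\<delta> l), which is one of the two powers of x/y in the sum,
  according to the sign of the logarithm.\<close>

lemma powr_ratio:
  assumes \<delta>: "0 < \<delta>"
  obtains B where "0 < B"
    "\<And>x y. 0 < x \<Longrightarrow> 0 < y \<Longrightarrow>
      \<omega> x powr k \<le> B * ((x / y) powr \<delta> + (x / y) powr - \<delta>) * \<omega> y powr k"
proof -
  obtain D where D: "0 < D" "\<And>x y. 0 < x \<Longrightarrow> 0 < y \<Longrightarrow> \<omega> x \<le> \<omega> y + D * (1 + \<bar>ln (x / y)\<bar>)"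
    using slowly_varying by metis
  \<comment> \<open>The summand 1 keeps m positive when k = 0, since l is scaled by \<delta>/m. The
    constant c comes from L \<le> (1 + D)(1 + l) and 1 + l \<le> (1 + m/\<delta>)(1 + \<delta>
    l/m).\<close>
  define m where "m = \<bar>k\<bar> + 1"
  define c where "c = (1 + D) * (1 + m / \<delta>)"
  have m: "m > 0" by (simp add: m_def)
  have "c > 0" using D m \<delta> by (auto simp: c_def intro!: mult_pos_pos add_pos_pos)
  have "\<omega> x powr k \<le> c powr m * ((x / y) powr \<delta> + (x / y) powr - \<delta>) * \<omega> y powr k"
    if xy: "0 < x" "0 < y" for x y
  proof -
    define l where "l = \<bar>ln (x / y)\<bar>"
    have l0: "0 \<le> l" by (simp add: l_def)
    define L where "L = 1 + D * (1 + l)"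
    have L1: "1 \<le> L" using D l0 by (simp add: L_def)
    have step: "\<omega> u \<le> L * \<omega> v" if "0 < u" "0 < v" "\<bar>ln (u / v)\<bar> = l" for u v
    proof -
      have "D * (1 + l) * 1 \<le> D * (1 + l) * \<omega> v"
        using D l0 ge_1 by (intro mult_left_mono) auto
      then show ?thesis using D(2)[OF that(1,2)] that(3) by (simp add: L_def algebra_simps)
    qed
    have "\<omega> x powr k \<le> L powr \<bar>k\<bar> * \<omega> y powr k"
      using xy ge_1[of x] ge_1[of y]
      by (intro powr_quotient_bound[OF L1] step) (auto simp: l_def ln_div)
    also have "L powr \<bar>k\<bar> \<le> L powr m"
      using L1 by (intro powr_mono) (auto simp: m_def)
    also have "L powr m \<le> (c * exp (\<delta> * l / m)) powr m"
    proof (rule powr_mono2)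
      have "(1 + l) \<le> (1 + m / \<delta>) * (1 + \<delta> * l / m)"
        using \<delta> m l0 by (simp add: field_simps)
      also have "\<dots> \<le> (1 + m / \<delta>) * exp (\<delta> * l / m)"
        using \<delta> m by (intro mult_left_mono exp_ge_add_one_self) auto
      finally have "(1 + D) * (1 + l) \<le> (1 + D) * ((1 + m / \<delta>) * exp (\<delta> * l / m))"
        using D by (intro mult_left_mono) auto
      moreover have "L \<le> (1 + D) * (1 + l)"
        using l0 D by (simp add: L_def algebra_simps)
      ultimately show "L \<le> c * exp (\<delta> * l / m)" by (simp add: c_def mult.assoc)
    qed (use L1 m in auto)
    also have "\<dots> = c powr m * exp (\<delta> * l)"
      using \<open>c > 0\<close> m by (simp add: powr_mult exp_powr_real)
    also have "exp (\<delta> * l) \<le> (x / y) powr \<delta> + (x / y) powr - \<delta>"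
      using xy by (cases "0 \<le> ln (x / y)") (simp_all add: l_def powr_def add_increasing add_increasing2)
    finally show ?thesis using \<open>c > 0\<close> by (simp add: mult_right_mono mult_left_mono)
  qed
  then show ?thesis using \<open>c > 0\<close> by (intro that[of "c powr m"]) auto
qed

text \<open>The point is the order of quantifiers: \<open>B\<close> does not depend on
  \<open>R\<close>, only \<open>A\<close> does. Without the \<Phi>(t) term \<omega> is bounded on
  [1,\<infinity>); with it, the start of the interval is pushed out until \<omega> exceeds the
  oscillation that slow variation permits.\<close>

lemma comparable_far_out:
  obtains B where "1 \<le> B"
    "\<And>R. 1 < R \<Longrightarrow> \<exists>A\<ge>1. \<forall>x\<in>{A..A * R}. \<forall>y\<in>{A..A * R}. \<omega> x powr k \<le> B * \<omega> y powr k"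
proof -
  obtain D where D: "0 < D" "\<And>x y. 0 < x \<Longrightarrow> 0 < y \<Longrightarrow> \<omega> x \<le> \<omega> y + D * (1 + \<bar>ln (x / y)\<bar>)"
    using slowly_varying by metis
  define L where "L = 1 + ln_plus (\<Phi> 1) + 2 * D"
  have L1: "1 \<le> L" using D by (simp add: L_def ln_plus_def)
  have "\<exists>A\<ge>1. \<forall>x\<in>{A..A * R}. \<forall>y\<in>{A..A * R}. \<omega> x \<le> L * \<omega> y" if R: "1 < R" for R
  proof (cases "snd \<epsilon> = 0")
    case True
    have "\<omega> x \<le> L * \<omega> y" if "x \<ge> 1" for x y
    proof -
      have "ln_plus (\<Phi> (1 / x)) \<le> ln_plus (\<Phi> 1)"
        using mono[of "1 / x" 1] pos[of "1 / x"] that by (auto simp: ln_plus_def max_def)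
      then have "\<omega> x \<le> 1 + ln_plus (\<Phi> 1)"
        using \<epsilon> True by (auto simp: log_weight_def ln_plus_def)
      also have "\<dots> \<le> L * 1" using D by (simp add: L_def)
      also have "\<dots> \<le> L * \<omega> y" using ge_1 L1 by (intro mult_left_mono) auto
      finally show ?thesis .
    qed
    then show ?thesis by (intro exI[of _ 1]) auto
  next
    case False
    \<comment> \<open>Surjectivity yields a point beyond which \<omega> \<ge> 1 + ln R. On an
      interval with endpoint ratio R the additive error is at most D (1 + ln R), hence at most D
      \<omega>(y).\<close>
    have "exp (1 + ln R) \<in> \<Phi> ` {0..}" using growth by (simp add: growth_function_def)
    then obtain A0 where A0: "0 \<le> A0" "\<Phi> A0 = exp (1 + ln R)" by auto
    define A where "A = max A0 1"
    have "\<omega> x \<le> L * \<omega> y" if xy: "x \<in> {A..A * R}" "y \<in> {A..A * R}" for x y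
    proof -
      have pos: "x \<ge> A" "y \<ge> A" "A \<ge> 1" using xy by (auto simp: A_def)
      have "exp (1 + ln R) \<le> \<Phi> y" using mono[of A0 y] A0 pos by (simp add: A_def)
      then have "1 + ln R \<le> ln (\<Phi> y)"
        by (subst ln_ge_iff) (auto intro: less_le_trans[OF exp_gt_zero])
      then have yR: "1 + ln R \<le> \<omega> y"
        using \<epsilon> False by (auto simp: log_weight_def ln_plus_def)
      have "\<bar>ln (x / y)\<bar> \<le> ln R"
      proof -
        have "ln A \<le> ln x" "ln A \<le> ln y" "ln x \<le> ln (A * R)" "ln y \<le> ln (A * R)"
          using xy pos R by auto
        moreover have "ln (A * R) = ln A + ln R" using pos R by (simp add: ln_mult)
        ultimately have "\<bar>ln x - ln y\<bar> \<le> ln R" by linarith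
        then show ?thesis using pos by (simp add: ln_div)
      qed
      then have "D * (1 + \<bar>ln (x / y)\<bar>) \<le> D * \<omega> y"
        using D yR by (intro mult_left_mono) auto
      then have "\<omega> x \<le> (1 + D) * \<omega> y"
        using D(2)[of x y] pos by (simp add: algebra_simps)
      also have "\<dots> \<le> L * \<omega> y"
        using ge_1[of y] D by (intro mult_right_mono) (auto simp: L_def ln_plus_def)
      finally show ?thesis .
    qed
    moreover have "1 \<le> A" by (simp add: A_def)
    ultimately show ?thesis by blast
  qed
  note * = this
  have pk: "\<omega> x powr k \<le> L powr \<bar>k\<bar> * \<omega> y powr k" if "\<omega> x \<le> L * \<omega> y" "\<omega> y \<le> L * \<omega> x" for x y
    using ge_1[of x] ge_1[of y] by (intro powr_quotient_bound L1 that) auto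
  show ?thesis
  proof (rule that[of "L powr \<bar>k\<bar>"])
    show "1 \<le> L powr \<bar>k\<bar>" using L1 by (simp add: ge_one_powr_ge_zero)
    show "\<exists>A\<ge>1. \<forall>x\<in>{A..A * R}. \<forall>y\<in>{A..A * R}. \<omega> x powr k \<le> L powr \<bar>k\<bar> * \<omega> y powr k"
      if "1 < R" for R using *[OF that] pk by blast
  qed
qed

end

section \<open>Integrals of 1/x, and the half-line as a measure space\<close>

lemma set_integral_inverse_Icc:
  fixes a b :: real
  assumes "0 < a" "a \<le> b"
  shows "set_integrable lborel {a..b} (\<lambda>x. 1 / x)"
    and "(LINT x:{a..b}|lborel. 1 / x) = ln (b / a)"
proof -
  show int: "set_integrable lborel {a..b} (\<lambda>x. 1 / x)"
    using assms by (intro borel_integrable_atLeastAtMost' continuous_intros) auto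
  have "((\<lambda>x. 1 / x) has_integral (ln b - ln a)) {a..b}"
    using assms by (intro fundamental_theorem_of_calculus)
      (auto intro!: derivative_eq_intros simp flip: has_real_derivative_iff_has_vector_derivative)
  then show "(LINT x:{a..b}|lborel. 1 / x) = ln (b / a)"
    using assms set_borel_integral_eq_integral(2)[OF int] by (simp add: ln_div integral_unique)
qed

abbreviation half_line :: "real measure" where
  "half_line \<equiv> restrict_space lborel {0<..}"

abbreviation Hilbert_kernel :: "real \<Rightarrow> real \<Rightarrow> real \<Rightarrow> real" where
  "Hilbert_kernel \<beta> x y \<equiv> y powr \<beta> / (x + y) powr (1 + \<beta>)"

lemma Hilbert_integrand_kernel:
  "Hilbert_integrand \<beta> f x y = f y * complex_of_real (Hilbert_kernel \<beta> x y)"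
  by (simp add: Hilbert_integrand_def)

lemma set_integrable_half_line:
  fixes f :: "real \<Rightarrow> 'b::{banach, second_countable_topology}"
  shows "set_integrable lborel {0<..} f \<longleftrightarrow> integrable half_line f"
  by (simp add: set_integrable_def integrable_restrict_space)

lemma set_lebesgue_integral_half_line:
  fixes f :: "real \<Rightarrow> 'b::{banach, second_countable_topology}"
  shows "(LINT x:{0<..}|lborel. f x) = (LINT x|half_line. f x)"
  by (simp add: set_lebesgue_integral_def integral_restrict_space)

lemma id_half_line_measurable: "(\<lambda>x. x) \<in> borel_measurable half_line"
  by (simp add: measurable_restrict_space1)

lemma sigma_finite_half_line: "sigma_finite_measure half_line"
  by (intro sigma_finite_measure_restrict_space sigma_finite_lborel) simp

lemma (in log_weight_setup) continuous_on_log_weight: "continuous_on {0<..} \<omega>"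
proof -
  have cont: "continuous_on {0..} \<Phi>" using growth by (simp add: growth_function_def)
  have "continuous_on {0<..} (\<lambda>t. \<Phi> (1 / t))"
    by (rule continuous_on_compose2[OF cont]) (auto intro!: continuous_intros)
  moreover have "continuous_on {0<..} \<Phi>"
    by (rule continuous_on_subset[OF cont]) auto
  ultimately show ?thesis
    unfolding log_weight_def ln_plus_def
    by (intro continuous_intros) (auto dest!: pos simp: less_imp_neq[symmetric] pos)
qed

lemma (in log_weight_setup) log_weight_measurable: "\<omega> \<in> borel_measurable half_line"
  using borel_measurable_continuous_on_restrict[OF continuous_on_log_weight]
  by (simp cong: measurable_cong_sets sets_restrict_space_cong)

section \<open>Sufficiency of the parameter condition\<close>

proposition (in log_weight_setup) bounded_if:
  assumes p: "1 \<le> p" and \<alpha>: "-1 < \<alpha>" and \<alpha>\<beta>: "\<alpha> + 1 < p * (\<beta> + 1)"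
  shows "Hilbert_operator_bounded_on \<beta> p (weighted_measure \<omega> k \<alpha>)"
proof -
  note [measurable] = log_weight_measurable id_half_line_measurable
  define a where "a = (\<alpha> + 1) / p"
  \<comment> \<open>Half the distance from a to the nearer end of the window (0, \<beta>+1), so that
    a - \<delta> and a + \<delta> stay inside.\<close>
  define \<delta> where "\<delta> = min a (\<beta> + 1 - a) / 2"
  have a: "0 < a" "a < \<beta> + 1" using p \<alpha> \<alpha>\<beta> by (auto simp: a_def field_simps)
  then have \<delta>: "0 < \<delta>" "0 < a - \<delta>" "a + \<delta> < \<beta> + 1" by (auto simp: \<delta>_def min_def field_simps)
  have ap: "a * p = \<alpha> + 1" using p by (simp add: a_def)
  define W where "W y = \<omega> y powr k * y powr \<alpha>" for y
  have M: "weighted_measure \<omega> k \<alpha> = density half_line (\<lambda>x. ennreal (W x))"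
    by (simp add: weighted_measure_def W_def)
  obtain B1 where B1: "0 < B1"
    "\<And>x. 0 < x \<Longrightarrow> (\<integral>\<^sup>+y. ennreal (y powr (\<beta> - a) / (x + y) powr (1 + \<beta>)) \<partial>half_line)
       \<le> ennreal (B1 * x powr (\<beta> - a - \<beta>))"
    using nn_integral_powr_kernel_le[of "\<beta> - a" \<beta>] a by auto
  \<comment> \<open>Two column integrals, one for each power of x/y in the bound for the ratio of
    the weights.\<close>
  obtain Bp where Bp: "0 < Bp"
    "\<And>y. 0 < y \<Longrightarrow> (\<integral>\<^sup>+x. ennreal (x powr (a - 1 + \<delta>) / (y + x) powr (1 + \<beta>)) \<partial>half_line)
       \<le> ennreal (Bp * y powr (a - 1 + \<delta> - \<beta>))"
    using nn_integral_powr_kernel_le[of "a - 1 + \<delta>" \<beta>] a \<delta> by auto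
  obtain Bm where Bm: "0 < Bm"
    "\<And>y. 0 < y \<Longrightarrow> (\<integral>\<^sup>+x. ennreal (x powr (a - 1 - \<delta>) / (y + x) powr (1 + \<beta>)) \<partial>half_line)
       \<le> ennreal (Bm * y powr (a - 1 - \<delta> - \<beta>))"
    using nn_integral_powr_kernel_le[of "a - 1 - \<delta>" \<beta>] a \<delta> by auto
  obtain B where B: "0 < B"
    "\<And>x y. 0 < x \<Longrightarrow> 0 < y \<Longrightarrow>
      \<omega> x powr k \<le> B * ((x / y) powr \<delta> + (x / y) powr - \<delta>) * \<omega> y powr k"
    using powr_ratio[OF \<delta>(1)] by metis
  define s where "s y = y powr - a" for y :: real
  define B2 where "B2 = B * (Bp + Bm)"
  have row: "(\<integral>\<^sup>+y. ennreal (Hilbert_kernel \<beta> x y * s y) \<partial>half_line) \<le> ennreal (B1 * s x)" if "0 < x" for x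
    using B1(2)[OF that] by (simp add: s_def powr_diff powr_minus_divide mult_ac)
  have col: "(\<integral>\<^sup>+x. ennreal (Hilbert_kernel \<beta> x y * s x powr (p - 1) * W x) \<partial>half_line)
      \<le> ennreal (B2 * s y powr (p - 1) * W y)" if y: "0 < y" for y
  proof -
    \<comment> \<open>The relation a p = \<alpha>+1 turns the exponent into a - 1, so without the
      weight the column integral converges in the same window for a as the row integral.\<close>
    have exps: "s x powr (p - 1) * x powr \<alpha> = x powr (a - 1)" if "0 < x" for x
    proof -
      have "- a * (p - 1) + \<alpha> = a - 1" using ap by (simp add: algebra_simps)
      then show ?thesis by (simp add: s_def powr_powr flip: powr_add)
    qed
    \<comment> \<open>Replacing \<omega>(x)^k by \<omega>(y)^k frees the integral over x from the
      weight; \<open>cp\<close> and \<open>cm\<close> collect the factors depending on y alone. The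
      extra powers of y, of exponents -\<delta> and \<delta>, cancel against those produced by the
      kernel integrals.\<close>
    define cp where "cp = B * \<omega> y powr k * y powr (\<beta> - \<delta>)"
    define cm where "cm = B * \<omega> y powr k * y powr (\<beta> + \<delta>)"
    have c: "0 \<le> cp" "0 \<le> cm" using B by (auto simp: cp_def cm_def)
    have "(\<integral>\<^sup>+x. ennreal (Hilbert_kernel \<beta> x y * s x powr (p - 1) * W x) \<partial>half_line)
      \<le> (\<integral>\<^sup>+x. ennreal cp * ennreal (x powr (a - 1 + \<delta>) / (y + x) powr (1 + \<beta>))
             + ennreal cm * ennreal (x powr (a - 1 - \<delta>) / (y + x) powr (1 + \<beta>)) \<partial>half_line)"
    proof (rule nn_integral_mono)
      fix x assume "x \<in> space half_line"
      then have x: "0 < x" by (simp add: space_restrict_space)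
      define r where "r = (y + x) powr (1 + \<beta>)"
      define t where "t = B * \<omega> y powr k"
      have plus: "(x / y) powr \<delta> * x powr (a - 1) * y powr \<beta> = y powr (\<beta> - \<delta>) * x powr (a - 1 + \<delta>)"
        using x y by (simp add: powr_divide powr_add powr_diff[of y \<beta> \<delta>])
      have minus: "(x / y) powr - \<delta> * x powr (a - 1) * y powr \<beta> = y powr (\<beta> + \<delta>) * x powr (a - 1 - \<delta>)"
        using x y by (simp add: powr_divide powr_minus_divide powr_add powr_diff[of x "a - 1" \<delta>])
      have "Hilbert_kernel \<beta> x y * s x powr (p - 1) * W x
          = Hilbert_kernel \<beta> x y * x powr (a - 1) * \<omega> x powr k"
        unfolding W_def exps[OF x, symmetric] by simp
      also have "\<dots> \<le> Hilbert_kernel \<beta> x y * x powr (a - 1)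
          * (B * ((x / y) powr \<delta> + (x / y) powr - \<delta>) * \<omega> y powr k)"
        by (intro mult_left_mono B x y) simp
      also have "\<dots> = t * ((x / y) powr \<delta> * x powr (a - 1) * y powr \<beta>) / r
          + t * ((x / y) powr - \<delta> * x powr (a - 1) * y powr \<beta>) / r"
        by (simp only: t_def r_def add.commute[of x y] add_divide_distrib[symmetric]
            distrib_left[symmetric] distrib_right[symmetric] times_divide_eq_left times_divide_eq_right)
          (simp only: mult_ac)
      also have "\<dots> = cp * (x powr (a - 1 + \<delta>) / r) + cm * (x powr (a - 1 - \<delta>) / r)"
        unfolding plus minus by (simp add: cp_def cm_def t_def)
      also note r_def
      finally show "ennreal (Hilbert_kernel \<beta> x y * s x powr (p - 1) * W x)
        \<le> ennreal cp * ennreal (x powr (a - 1 + \<delta>) / (y + x) powr (1 + \<beta>))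
             + ennreal cm * ennreal (x powr (a - 1 - \<delta>) / (y + x) powr (1 + \<beta>))"
        using c by (simp add: ennreal_leI flip: ennreal_mult' ennreal_plus)
    qed
    also have "\<dots> = ennreal cp * (\<integral>\<^sup>+x. ennreal (x powr (a - 1 + \<delta>) / (y + x) powr (1 + \<beta>)) \<partial>half_line)
       + ennreal cm * (\<integral>\<^sup>+x. ennreal (x powr (a - 1 - \<delta>) / (y + x) powr (1 + \<beta>)) \<partial>half_line)"
      by (simp add: nn_integral_add nn_integral_cmult)
    also have "\<dots> \<le> ennreal cp * ennreal (Bp * y powr (a - 1 + \<delta> - \<beta>))
        + ennreal cm * ennreal (Bm * y powr (a - 1 - \<delta> - \<beta>))"
      using Bp Bm y by (intro add_mono mult_left_mono) auto
    also have "\<dots> = ennreal (cp * (Bp * y powr (a - 1 + \<delta> - \<beta>)) + cm * (Bm * y powr (a - 1 - \<delta> - \<beta>)))"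
      using c Bp Bm by (simp add: ennreal_mult')
    also have "cp * (Bp * y powr (a - 1 + \<delta> - \<beta>)) + cm * (Bm * y powr (a - 1 - \<delta> - \<beta>))
        = B2 * (y powr (a - 1)) * \<omega> y powr k"
    proof -
      have "y powr (\<beta> - \<delta>) * y powr (a - 1 + \<delta> - \<beta>) = y powr (a - 1)"
        "y powr (\<beta> + \<delta>) * y powr (a - 1 - \<delta> - \<beta>) = y powr (a - 1)"
        by (simp_all flip: powr_add)
      then have "B * \<omega> y powr k * Bp * (y powr (\<beta> - \<delta>) * y powr (a - 1 + \<delta> - \<beta>))
          + B * \<omega> y powr k * Bm * (y powr (\<beta> + \<delta>) * y powr (a - 1 - \<delta> - \<beta>))
          = B2 * (y powr (a - 1)) * \<omega> y powr k"
        by (simp add: B2_def distrib_left distrib_right)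
      then show ?thesis by (simp only: cp_def cm_def mult_ac)
    qed
    also have "\<dots> = B2 * s y powr (p - 1) * W y"
      unfolding W_def exps[OF y, symmetric] by simp
    finally show ?thesis .
  qed
  define C where "C = B1 powr (p - 1) * B2"
  have B2: "0 < B2" using B Bp Bm by (simp add: B2_def)
  then have C: "0 < C" using B1 by (simp add: C_def)
  show ?thesis
    unfolding Hilbert_operator_bounded_on_def
  proof (intro exI[of _ "C powr (1 / p)"] conjI ballI)
    show "0 \<le> C powr (1 / p)" by simp
    fix f assume f: "f \<in> Lp p (weighted_measure \<omega> k \<alpha>)"
    have Wpos: "0 < W y" if "0 < y" for y using ge_1[of y] that by (simp add: W_def)
    have T: "Hilbert_operator \<beta> f = (\<lambda>x. LINT y|half_line. f y * complex_of_real (Hilbert_kernel \<beta> x y))"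
      by (simp add: fun_eq_iff Hilbert_operator_def set_lebesgue_integral_half_line Hilbert_integrand_kernel)
    have [measurable]: "s \<in> borel_measurable half_line" "W \<in> borel_measurable half_line"
      unfolding s_def W_def by measurable
    have Kmeas: "case_prod (Hilbert_kernel \<beta>) \<in> borel_measurable (half_line \<Otimes>\<^sub>M half_line)"
      by measurable
    have S: "AE x in density half_line (\<lambda>x. ennreal (W x)).
          integrable half_line (\<lambda>y. f y * complex_of_real (Hilbert_kernel \<beta> x y))"
      "(\<lambda>x. LINT y|half_line. f y * complex_of_real (Hilbert_kernel \<beta> x y)) \<in> Lp p (density half_line (\<lambda>x. ennreal (W x)))"
      "(LINT x|density half_line (\<lambda>x. ennreal (W x)). norm (LINT y|half_line. f y * complex_of_real (Hilbert_kernel \<beta> x y)) powr p)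
        \<le> C * (LINT x|density half_line (\<lambda>x. ennreal (W x)). norm (f x) powr p)"
      unfolding C_def
      using Schur_test[OF sigma_finite_half_line p Kmeas \<open>s \<in> borel_measurable half_line\<close>
        \<open>W \<in> borel_measurable half_line\<close> _ _ _ B1(1) B2 _ _ f[unfolded M]] row col Wpos
      by (simp_all add: space_restrict_space s_def)
    show "AE x in weighted_measure \<omega> k \<alpha>. set_integrable lborel {0<..} (Hilbert_integrand \<beta> f x)"
      using S(1) unfolding M set_integrable_half_line Hilbert_integrand_kernel .
    show "Hilbert_operator \<beta> f \<in> Lp p (weighted_measure \<omega> k \<alpha>)"
      using S(2) by (simp add: M T)
    show "Lp_norm p (weighted_measure \<omega> k \<alpha>) (Hilbert_operator \<beta> f)
        \<le> C powr (1 / p) * Lp_norm p (weighted_measure \<omega> k \<alpha>) f"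
      using powr_mono2[OF _ _ S(3), of "1 / p"] p C by (simp add: Lp_norm_def M T powr_mult)
  qed
qed

section \<open>Necessity of the parameter condition\<close>

context log_weight_setup
begin

lemma integral_weighted_measure:
  fixes g :: "real \<Rightarrow> real"
  assumes "g \<in> borel_measurable half_line"
  shows "integrable (weighted_measure \<omega> k \<alpha>) g \<longleftrightarrow>
      set_integrable lborel {0<..} (\<lambda>x. \<omega> x powr k * x powr \<alpha> * g x)"
    and "(LINT x|weighted_measure \<omega> k \<alpha>. g x) = (LINT x:{0<..}|lborel. \<omega> x powr k * x powr \<alpha> * g x)"
proof -
  note [measurable] = log_weight_measurable id_half_line_measurable assms
  show "integrable (weighted_measure \<omega> k \<alpha>) g \<longleftrightarrow>
      set_integrable lborel {0<..} (\<lambda>x. \<omega> x powr k * x powr \<alpha> * g x)"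
    unfolding weighted_measure_def set_integrable_half_line
    by (subst integrable_density) auto
  show "(LINT x|weighted_measure \<omega> k \<alpha>. g x) = (LINT x:{0<..}|lborel. \<omega> x powr k * x powr \<alpha> * g x)"
    unfolding weighted_measure_def set_lebesgue_integral_half_line
    by (subst integral_density) auto
qed

lemma set_integrable_weight:
  assumes "0 < a"
  shows "set_integrable lborel {a..b} (\<lambda>x. \<omega> x powr k * x powr \<gamma>)"
proof -
  have "\<omega> x \<noteq> 0" for x using ge_1[of x] by auto
  moreover have "continuous_on {a..b} \<omega>"
    using assms by (intro continuous_on_subset[OF continuous_on_log_weight]) auto
  ultimately show ?thesis
    using assms by (intro borel_integrable_atLeastAtMost' continuous_intros) auto
qed

text \<open>
  Where the weight is essentially constant, the upper half \<open>[A R, A R\<^sup>2]\<close> of the interval carries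
  a fixed proportion of the mass, as \<open>\<gamma> \<ge> -1\<close>.
\<close>

lemma half_mass:
  assumes B: "1 \<le> B" and A: "1 \<le> A" and R: "1 < R" and \<gamma>: "-1 \<le> \<gamma>"
    and comp: "\<And>x y. x \<in> {A..A * R\<^sup>2} \<Longrightarrow> y \<in> {A..A * R\<^sup>2} \<Longrightarrow> \<omega> x powr k \<le> B * \<omega> y powr k"
  shows "(LINT x:{A..A * R\<^sup>2}|lborel. \<omega> x powr k * x powr \<gamma>)
      \<le> (1 + B\<^sup>2) * (LINT x:{A * R..A * R\<^sup>2}|lborel. \<omega> x powr k * x powr \<gamma>)"
    and "0 < (LINT x:{A * R..A * R\<^sup>2}|lborel. \<omega> x powr k * x powr \<gamma>)"
proof -
  let ?w = "\<lambda>x. \<omega> x powr k * x powr \<gamma>"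
  \<comment> \<open>The function \<omega>^k x^(\<gamma>+1) with the weight frozen at A and the power
    at the common endpoint A R. As \<gamma>+1 \<ge> 0, the function is at most B S on the lower half
    and at least S/B on the upper half. Both halves have length ln R for dx/x, so their masses
    differ by a factor of at most B^2.\<close>
  define S where "S = \<omega> A powr k * (A * R) powr (\<gamma> + 1)"
  have AR: "A < A * R" "A * R < A * R\<^sup>2" using A R by (auto simp: power2_eq_square)
  have S: "0 < S" using ge_1[of A] AR A by (simp add: S_def)
  have split: "?w x = \<omega> x powr k * x powr (\<gamma> + 1) * (1 / x)" if "0 < x" for x
    using that by (simp add: powr_add)
  have wpos: "0 < \<omega> x powr k" for x using ge_1[of x] by simp
  have "(LINT x:{A..A * R}|lborel. ?w x) \<le> (LINT x:{A..A * R}|lborel. B * S * (1 / x))"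
  proof (rule set_integral_mono)
    show "set_integrable lborel {A..A * R} ?w" using A by (intro set_integrable_weight) auto
    show "set_integrable lborel {A..A * R} (\<lambda>x. B * S * (1 / x))"
      using A AR by (intro set_integrable_mult_right set_integral_inverse_Icc) auto
    fix x assume x: "x \<in> {A..A * R}"
    then have "x \<in> {A..A * R\<^sup>2}" using AR by auto
    then have "\<omega> x powr k * x powr (\<gamma> + 1) \<le> (B * \<omega> A powr k) * (A * R) powr (\<gamma> + 1)"
      using x A AR \<gamma> B by (intro mult_mono comp powr_mono2) auto
    then show "?w x \<le> B * S * (1 / x)"
      using x A by (subst split) (auto simp: S_def mult.assoc intro!: divide_right_mono)
  qed
  also have "\<dots> = B * S * ln R"
    using A AR by (subst set_integral_mult_right) (simp add: set_integral_inverse_Icc)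
  finally have lower: "(LINT x:{A..A * R}|lborel. ?w x) \<le> B * S * ln R" .
  have "(LINT x:{A * R..A * R\<^sup>2}|lborel. S / B * (1 / x)) \<le> (LINT x:{A * R..A * R\<^sup>2}|lborel. ?w x)"
  proof (rule set_integral_mono)
    show "set_integrable lborel {A * R..A * R\<^sup>2} ?w" using A AR by (intro set_integrable_weight) auto
    show "set_integrable lborel {A * R..A * R\<^sup>2} (\<lambda>x. S / B * (1 / x))"
      using A AR by (intro set_integrable_mult_right set_integral_inverse_Icc) auto
    fix x assume x: "x \<in> {A * R..A * R\<^sup>2}"
    then have Ax: "A \<le> x" using AR(1) unfolding atLeastAtMost_iff by linarith
    then have "S \<le> (B * \<omega> x powr k) * x powr (\<gamma> + 1)"
      unfolding S_def using x A AR \<gamma> B by (intro mult_mono comp powr_mono2) auto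
    then have "S / B \<le> \<omega> x powr k * x powr (\<gamma> + 1)"
      using B by (simp add: field_simps)
    then have "S / B * (1 / x) \<le> \<omega> x powr k * x powr (\<gamma> + 1) * (1 / x)"
      using Ax A by (intro mult_right_mono) auto
    then show "S / B * (1 / x) \<le> ?w x"
      using Ax A by (subst split) auto
  qed
  moreover have "(LINT x:{A * R..A * R\<^sup>2}|lborel. S / B * (1 / x)) = S / B * ln (A * R\<^sup>2 / (A * R))"
    using A AR by (subst set_integral_mult_right) (simp add: set_integral_inverse_Icc)
  moreover have "A * R\<^sup>2 / (A * R) = R" using A R by (simp add: power2_eq_square)
  ultimately have upper: "S / B * ln R \<le> (LINT x:{A * R..A * R\<^sup>2}|lborel. ?w x)" by simp
  have "0 < S / B * ln R" using S B R by simp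
  with upper show "0 < (LINT x:{A * R..A * R\<^sup>2}|lborel. ?w x)" by linarith
  have "B * S * ln R = B\<^sup>2 * (S / B * ln R)" using B by (simp add: power2_eq_square)
  also have "\<dots> \<le> B\<^sup>2 * (LINT x:{A * R..A * R\<^sup>2}|lborel. ?w x)"
    using upper by (intro mult_left_mono) auto
  finally have "(LINT x:{A..A * R}|lborel. ?w x) \<le> B\<^sup>2 * (LINT x:{A * R..A * R\<^sup>2}|lborel. ?w x)"
    using lower by linarith
  moreover have "(LINT x:{A..A * R} \<union> {A * R..A * R\<^sup>2}|lborel. ?w x)
      = (LINT x:{A..A * R}|lborel. ?w x) + (LINT x:{A * R..A * R\<^sup>2}|lborel. ?w x)"
  proof (rule set_integral_Un_AE)
    show "AE x in lborel. \<not> (x \<in> {A..A * R} \<and> x \<in> {A * R..A * R\<^sup>2})"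
      using AE_lborel_singleton[of "A * R"] by eventually_elim auto
  qed (use A AR in \<open>auto intro!: set_integrable_weight\<close>)
  moreover have "{A..A * R} \<union> {A * R..A * R\<^sup>2} = {A..A * R\<^sup>2}" using AR by auto
  ultimately show "(LINT x:{A..A * R\<^sup>2}|lborel. ?w x) \<le> (1 + B\<^sup>2) * (LINT x:{A * R..A * R\<^sup>2}|lborel. ?w x)"
    by (simp add: algebra_simps)
qed

text \<open>On the support f(y) y^\<beta> = 1/y, and for y \<le> A R \<le> x the denominator is at
  most (2x)^(1+\<beta>); integrating 1/y over [A, A R] yields ln R. The integrand is nonnegative, so
  the rest of the support can only add.\<close>

lemma Hilbert_operator_truncated_power_ge:
  fixes \<beta> A R b :: real
  defines "f \<equiv> \<lambda>y. complex_of_real (indicator {A..b} y * y powr (- \<beta> - 1))"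
  assumes \<beta>: "-1 < \<beta>" and A: "0 < A" and R: "1 < R" and x: "A * R \<le> x" "x \<le> b"
  shows "(2 * x) powr (- \<beta> - 1) * ln R \<le> norm (Hilbert_operator \<beta> f x)"
proof -
  have AR: "A < A * R" using A R by simp
  have x0: "0 < x" using A AR x by linarith
  define g where "g y = (1 / y) / (x + y) powr (1 + \<beta>)" for y
  have gI: "set_integrable lborel {A..b} g"
    unfolding g_def using A x0 by (intro borel_integrable_atLeastAtMost' continuous_intros) auto
  have "Hilbert_operator \<beta> f x = (LINT y|lborel. complex_of_real (indicator {A..b} y * g y))"
    unfolding Hilbert_operator_def set_lebesgue_integral_def
  proof (rule Bochner_Integration.integral_cong)
    fix y :: real
    have "y powr (- \<beta> - 1) * y powr \<beta> = 1 / y" if "A \<le> y"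
      using that A by (simp add: powr_minus_divide flip: powr_add)
    then show "indicator {0<..} y *\<^sub>R Hilbert_integrand \<beta> f x y = complex_of_real (indicator {A..b} y * g y)"
      using A by (auto simp: indicator_def Hilbert_integrand_def f_def g_def simp flip: of_real_mult of_real_divide)
  qed simp
  also have "\<dots> = complex_of_real (LINT y:{A..b}|lborel. g y)"
    by (subst integral_complex_of_real) (simp add: set_lebesgue_integral_def)
  finally have H: "Hilbert_operator \<beta> f x = complex_of_real (LINT y:{A..b}|lborel. g y)" .
  have "(LINT y:{A..A * R}|lborel. (2 * x) powr (- \<beta> - 1) * (1 / y)) \<le> (LINT y:{A..A * R}|lborel. g y)"
  proof (rule set_integral_mono)
    show "set_integrable lborel {A..A * R} (\<lambda>y. (2 * x) powr (- \<beta> - 1) * (1 / y))"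
      using A AR by (intro set_integrable_mult_right set_integral_inverse_Icc) auto
    show "set_integrable lborel {A..A * R} g"
      using x by (intro set_integrable_subset[OF gI]) auto
    fix y assume y: "y \<in> {A..A * R}"
    have "(x + y) powr (1 + \<beta>) \<le> (2 * x) powr (1 + \<beta>)"
      using y x A x0 \<beta> by (intro powr_mono2) auto
    then have "(1 / y) / (2 * x) powr (1 + \<beta>) \<le> g y"
      unfolding g_def using y A x0 by (intro divide_left_mono) auto
    moreover have "- \<beta> - 1 = - (1 + \<beta>)" by simp
    ultimately show "(2 * x) powr (- \<beta> - 1) * (1 / y) \<le> g y"
      by (simp only: powr_minus_divide) (simp add: mult.commute)
  qed
  moreover have "(LINT y:{A..A * R}|lborel. (2 * x) powr (- \<beta> - 1) * (1 / y)) = (2 * x) powr (- \<beta> - 1) * ln R"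
    using A AR by (subst set_integral_mult_right) (simp add: set_integral_inverse_Icc)
  moreover have "(LINT y:{A..A * R}|lborel. g y) \<le> (LINT y:{A..b}|lborel. g y)"
    unfolding set_lebesgue_integral_def
  proof (rule integral_mono)
    show "integrable lborel (\<lambda>y. indicator {A..A * R} y *\<^sub>R g y)"
      using x set_integrable_subset[OF gI, of "{A..A * R}"] by (auto simp: set_integrable_def)
    show "integrable lborel (\<lambda>y. indicator {A..b} y *\<^sub>R g y)"
      using gI by (simp add: set_integrable_def)
    show "indicator {A..A * R} y *\<^sub>R g y \<le> indicator {A..b} y *\<^sub>R g y" for y
      using x A by (auto simp: indicator_def g_def)
  qed
  ultimately show ?thesis unfolding H by simp
qed

proposition bounded_only_if:
  assumes p: "1 \<le> p" and \<beta>: "-1 < \<beta>"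
    and bdd: "Hilbert_operator_bounded_on \<beta> p (weighted_measure \<omega> k \<alpha>)"
  shows "\<alpha> + 1 < p * (\<beta> + 1)"
proof (rule ccontr)
  note [measurable] = id_half_line_measurable
  let ?M = "weighted_measure \<omega> k \<alpha>"
  define \<gamma> where "\<gamma> = \<alpha> - p * (\<beta> + 1)"
  assume "\<not> \<alpha> + 1 < p * (\<beta> + 1)"
  then have \<gamma>: "-1 \<le> \<gamma>" by (simp add: \<gamma>_def)
  obtain C where C: "0 \<le> C"
    "\<And>f. f \<in> Lp p ?M \<Longrightarrow> Hilbert_operator \<beta> f \<in> Lp p ?M"
    "\<And>f. f \<in> Lp p ?M \<Longrightarrow> Lp_norm p ?M (Hilbert_operator \<beta> f) \<le> C * Lp_norm p ?M f"
    using bdd unfolding Hilbert_operator_bounded_on_def by blast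
  obtain B where B: "1 \<le> B"
    "\<And>R. 1 < R \<Longrightarrow> \<exists>A\<ge>1. \<forall>x\<in>{A..A * R}. \<forall>y\<in>{A..A * R}. \<omega> x powr k \<le> B * \<omega> y powr k"
    using comparable_far_out by metis
  \<comment> \<open>\<open>d\<close> is the p-th power of the factor 2^(-\<beta>-1) from the lower
    bound for the image. Boundedness will force (ln R)^p \<le> Q, which R = exp (Q + 1) violates
    because (Q+1)^p \<ge> Q + 1. \<open>B\<close> and \<open>C\<close> are fixed before R, so the
    choice is not circular.\<close>
  define d where "d = 2 powr (- (p * (\<beta> + 1)))"
  define Q where "Q = C powr p * (1 + B\<^sup>2) / d"
  have d: "0 < d" by (simp add: d_def)
  have Q0: "0 \<le> Q" using d by (simp add: Q_def)
  define R where "R = exp (Q + 1)"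
  have R: "1 < R" using Q0 by (simp add: R_def)
  have "1 < R\<^sup>2" using R by (simp add: one_less_power)
  from B(2)[OF this] obtain A where A: "1 \<le> A"
    and comp: "\<And>x y. x \<in> {A..A * R\<^sup>2} \<Longrightarrow> y \<in> {A..A * R\<^sup>2} \<Longrightarrow> \<omega> x powr k \<le> B * \<omega> y powr k"
    by blast
  have AR: "A < A * R" "A * R < A * R\<^sup>2" using A R by (auto simp: power2_eq_square)
  define f where "f y = complex_of_real (indicator {A..A * R\<^sup>2} y * y powr (- \<beta> - 1))" for y
  define J where "J = (LINT x:{A * R..A * R\<^sup>2}|lborel. \<omega> x powr k * x powr \<gamma>)"
  note half = half_mass[OF B(1) A R \<gamma> comp, folded J_def]
  have M_eq: "borel_measurable ?M = borel_measurable half_line"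
    by (intro measurable_cong_sets) (simp_all add: weighted_measure_def)
  \<comment> \<open>The p-th power of x^(-\<beta>-1), the profile of both f and the lower bound for
    its image, changes the exponent \<alpha> of the measure into \<gamma>.\<close>
  have wexp: "x powr \<alpha> * (x powr (- \<beta> - 1)) powr p = x powr \<gamma>" for x :: real
  proof -
    have "\<alpha> + (- \<beta> - 1) * p = \<gamma>" by (simp add: \<gamma>_def algebra_simps)
    then show ?thesis by (simp add: powr_powr flip: powr_add)
  qed
  have f_meas[measurable]: "f \<in> borel_measurable half_line"
  proof -
    have "f \<in> borel_measurable borel" unfolding f_def by measurable
    then show ?thesis by (simp add: measurable_restrict_space1)
  qed
  have f_eq: "indicator {0<..} x * (\<omega> x powr k * x powr \<alpha> * norm (f x) powr p)
      = indicator {A..A * R\<^sup>2} x * (\<omega> x powr k * x powr \<gamma>)" for x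
    using A wexp[of x] p by (auto simp: indicator_def f_def norm_mult)
  have f: "f \<in> Lp p ?M"
    unfolding Lp_def using set_integrable_weight[of A "A * R\<^sup>2" k \<gamma>] A
    by (simp add: M_eq integral_weighted_measure(1) set_integrable_def f_eq)
  have If: "(LINT x|?M. norm (f x) powr p) = (LINT x:{A..A * R\<^sup>2}|lborel. \<omega> x powr k * x powr \<gamma>)"
    unfolding set_lebesgue_integral_def
    by (subst integral_weighted_measure(2)) (simp_all add: set_lebesgue_integral_def f_eq)
  let ?H = "Hilbert_operator \<beta> f"
  have H_meas[measurable]: "?H \<in> borel_measurable half_line"
    and H_int: "integrable ?M (\<lambda>x. norm (?H x) powr p)"
    using C(2)[OF f] by (auto simp: Lp_def M_eq)
  have "d * (ln R) powr p * J = (LINT x:{A * R..A * R\<^sup>2}|lborel. d * (ln R) powr p * (\<omega> x powr k * x powr \<gamma>))"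
    by (simp add: J_def)
  also have "\<dots> \<le> (LINT x:{0<..}|lborel. \<omega> x powr k * x powr \<alpha> * norm (?H x) powr p)"
    unfolding set_lebesgue_integral_def
  proof (rule integral_mono)
    have "set_integrable lborel {A * R..A * R\<^sup>2} (\<lambda>x. d * (ln R) powr p * (\<omega> x powr k * x powr \<gamma>))"
      using A AR by (intro set_integrable_mult_right set_integrable_weight) auto
    then show "integrable lborel (\<lambda>x. indicator {A * R..A * R\<^sup>2} x *\<^sub>R (d * (ln R) powr p * (\<omega> x powr k * x powr \<gamma>)))"
      by (simp add: set_integrable_def)
    show "integrable lborel (\<lambda>x. indicator {0<..} x *\<^sub>R (\<omega> x powr k * x powr \<alpha> * norm (?H x) powr p))"
      using H_int by (simp add: integral_weighted_measure(1) set_integrable_def)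
    fix x
    show "indicator {A * R..A * R\<^sup>2} x *\<^sub>R (d * (ln R) powr p * (\<omega> x powr k * x powr \<gamma>))
        \<le> indicator {0<..} x *\<^sub>R (\<omega> x powr k * x powr \<alpha> * norm (?H x) powr p)"
    proof (cases "x \<in> {A * R..A * R\<^sup>2}")
      case True
      then have x0: "0 < x" using A AR(1) unfolding atLeastAtMost_iff by linarith
      have "d * (ln R) powr p * x powr \<gamma> = x powr \<alpha> * ((2 * x) powr (- \<beta> - 1) * ln R) powr p"
      proof -
        have "- (p * (\<beta> + 1)) = (- \<beta> - 1) * p" by (simp add: algebra_simps)
        then have "d = (2 powr (- \<beta> - 1)) powr p" by (simp add: d_def powr_powr)
        then show ?thesis using x0 R by (simp add: powr_mult flip: wexp)
      qed
      also have "\<dots> \<le> x powr \<alpha> * norm (?H x) powr p"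
        using True A R p \<beta> x0 unfolding f_def
        by (intro mult_left_mono powr_mono2 Hilbert_operator_truncated_power_ge) auto
      finally have "\<omega> x powr k * (d * (ln R) powr p * x powr \<gamma>)
          \<le> \<omega> x powr k * (x powr \<alpha> * norm (?H x) powr p)"
        by (intro mult_left_mono) auto
      then show ?thesis using True x0 by (simp add: mult_ac)
    qed auto
  qed
  also have "\<dots> = (LINT x|?M. norm (?H x) powr p)"
    by (rule integral_weighted_measure(2)[symmetric]) measurable
  also have "\<dots> = Lp_norm p ?M ?H powr p"
    using p by (simp add: Lp_norm_def powr_powr)
  also have "\<dots> \<le> (C * Lp_norm p ?M f) powr p"
    using p C(3)[OF f] by (intro powr_mono2) (auto simp: Lp_norm_def)
  also have "\<dots> = C powr p * (LINT x|?M. norm (f x) powr p)"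
    using p C(1) by (simp add: Lp_norm_def powr_powr powr_mult)
  also have "\<dots> \<le> C powr p * ((1 + B\<^sup>2) * J)"
    unfolding If by (intro mult_left_mono half(1)) auto
  finally have "d * (ln R) powr p * J \<le> C powr p * (1 + B\<^sup>2) * J"
    by (simp add: mult.assoc)
  \<comment> \<open>J depends on A and R, but it is positive and cancels; what remains involves only
    constants chosen before R.\<close>
  then have "d * (ln R) powr p \<le> C powr p * (1 + B\<^sup>2)"
    using half(2) by simp
  then have "(ln R) powr p \<le> Q"
    using d by (simp add: Q_def field_simps)
  moreover have "(Q + 1) powr 1 \<le> (Q + 1) powr p"
    using p Q0 by (intro powr_mono) auto
  ultimately show False using Q0 by (simp add: R_def)
qed

end

theorem theorem2:
  fixes p \<alpha> \<beta> k :: real and \<Phi> :: "real \<Rightarrow> real" and \<epsilon> :: "real \<times> real"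
  assumes "1 \<le> p" and "\<alpha> > -1" and "\<beta> > -1"
    and "\<Phi> \<in> growth_lower \<union> growth_upper"
    and "\<epsilon> \<in> {0, 1} \<times> {0, 1}"
  shows "Hilbert_operator_bounded_on \<beta> p (weighted_measure (log_weight \<Phi> \<epsilon>) k \<alpha>)
           \<longleftrightarrow> \<alpha> + 1 < p * (\<beta> + 1)"
proof -
  interpret log_weight_setup \<Phi> \<epsilon>
    using assms(4,5) by unfold_locales
  show ?thesis
    using bounded_if bounded_only_if assms(1-3) by blast
qed

end
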